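(* For any $x\in\left(0,\frac{\pi}{2}\right]$ and any $t>0$ one has $$2\left(\frac{\sinh x}{x}\right)^t+\left(\frac{\sin x}{x}\right)^t>3$$ and $$2\left(\frac{x}{\sin x}\right)^t+\left(\frac{x}{\sinh x}\right)^t>3 .$$ *)

theory Defs
  imports Complex_Main
begin

end

theory Submission
  imports Defs
begin

text \<open>
  If \<open>a\<^sup>2 b > 1\<close> then \<open>2 a\<^sup>t + b\<^sup>t > 3\<close> for all \<open>t > 0\<close>, by the
  arithmetic-geometric mean inequality. It remains to show
  \<open>sin\<^sup>2 x sinh x < x\<^sup>3 < sinh\<^sup>2 x sin x\<close>. The upper bound follows from
  \<open>sin x > x - x\<^sup>3/6\<close> and \<open>sinh x > x + x\<^sup>3/6\<close> since \<open>\<pi>\<^sup>2/4 < 3\<close>, the lower one from \<open>sin x < x\<close> and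
  \<open>sin x sinh x < x\<^sup>2\<close>; the last inequality holds because the fourth derivative of
  \<open>x\<^sup>2 - sin x sinh x\<close> is \<open>4 sin x sinh x\<close>.
\<close>

lemma two_powr_add_powr_gt_3:
  fixes a b t :: real
  assumes "a > 0" "b > 0" "a\<^sup>2 * b > 1" "t > 0"
  shows "2 * a powr t + b powr t > 3"
proof (rule ccontr)
  define p where "p = a powr t"
  define q where "q = b powr t"
  assume "\<not> 2 * a powr t + b powr t > 3"
  then have "q \<le> 3 - 2 * p" by (simp add: p_def q_def)
  then have "p\<^sup>2 * q \<le> p\<^sup>2 * (3 - 2 * p)" by (intro mult_left_mono) auto
  \<comment> \<open>This is AM-GM for \<open>p\<close>, \<open>p\<close>, \<open>q\<close> with sum
    at most 3: the cubic \<open>p\<^sup>2 * (3 - 2 * p)\<close> attains the value 1 doubly at the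
    equality case \<open>p = 1\<close>.\<close>
  also have "\<dots> = 1 - (p - 1)\<^sup>2 * (2 * p + 1)" by algebra
  also have "\<dots> \<le> 1" by (simp add: p_def)
  finally have "p\<^sup>2 * q \<le> 1" .
  moreover have "p\<^sup>2 * q = (a\<^sup>2 * b) powr t"
    using assms by (simp add: p_def q_def powr_mult power2_eq_square)
  moreover have "(a\<^sup>2 * b) powr t > 1" using assms by simp
  ultimately show False by simp
qed

text \<open>Serves to integrate inequalities from 0: each Taylor bound below is the positivity of a
  difference whose derivative is the difference in an earlier bound. Positivity of \<open>f'\<close>
  is asked only inside the interval, since these differences vanish at 0.\<close>

lemma pos_if_deriv_pos:
  fixes f f' :: "real \<Rightarrow> real"
  assumes "x > 0" "f 0 = 0"
    and "\<And>y. (f has_real_derivative f' y) (at y)"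
    and "\<And>y. 0 < y \<Longrightarrow> y < x \<Longrightarrow> f' y > 0"
  shows "f x > 0"
proof -
  have "f 0 < f x"
  proof (rule DERIV_pos_imp_increasing_open[OF \<open>x > 0\<close>])
    show "continuous_on {0..x} f"
      by (rule DERIV_continuous_on, rule has_field_derivative_at_within, rule assms(3))
  qed (use assms(3,4) in blast)
  then show ?thesis using assms(2) by simp
qed

lemma sin_less_self:
  fixes x :: real
  assumes "x > 0"
  shows "sin x < x"
proof (cases "x > 1")
  case True
  then show ?thesis using sin_le_one[of x] by linarith
next
  case False
  \<comment> \<open>Restricting to x \<le> 1 keeps \<open>y\<close> in [0, \<pi>], where the cosine
    is strictly decreasing; for arbitrary \<open>y > 0\<close> the bound fails at multiples of
    2\<pi>.\<close>
  have "cos y < 1" if "0 < y" "y < x" for y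
    using cos_monotone_0_pi[of 0 y] that False pi_ge_two by simp
  then have "x - sin x > 0"
    by (intro pos_if_deriv_pos[where f = "\<lambda>y. y - sin y"
        and f' = "\<lambda>y. 1 - cos y"])
      (auto intro!: derivative_eq_intros assms)
  then show ?thesis by simp
qed

lemma cos_gt_quadratic:
  fixes x :: real
  assumes "x > 0"
  shows "cos x > 1 - x\<^sup>2 / 2"
proof -
  have "cos x - (1 - x\<^sup>2 / 2) > 0"
    by (rule pos_if_deriv_pos[where f = "\<lambda>y. cos y - (1 - y\<^sup>2 / 2)"
        and f' = "\<lambda>y. y - sin y"])
      (auto intro!: derivative_eq_intros sin_less_self assms)
  then show ?thesis by simp
qed

lemma sin_gt_cubic:
  fixes x :: real
  assumes "x > 0"
  shows "sin x > x - x ^ 3 / 6"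
proof -
  have "sin x - (x - x ^ 3 / 6) > 0"
    by (rule pos_if_deriv_pos[where f = "\<lambda>y. sin y - (y - y ^ 3 / 6)"
        and f' = "\<lambda>y. cos y - (1 - y\<^sup>2 / 2)"])
      (auto intro!: derivative_eq_intros assms cos_gt_quadratic)
  then show ?thesis by simp
qed

lemma cos_less_quartic:
  fixes x :: real
  assumes "x > 0"
  shows "cos x < 1 - x\<^sup>2 / 2 + x ^ 4 / 24"
proof -
  have "1 - x\<^sup>2 / 2 + x ^ 4 / 24 - cos x > 0"
    by (rule pos_if_deriv_pos[where f = "\<lambda>y. 1 - y\<^sup>2 / 2 + y ^ 4 / 24 - cos y"
        and f' = "\<lambda>y. sin y - (y - y ^ 3 / 6)"])
      (auto intro!: derivative_eq_intros assms sin_gt_cubic)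
  then show ?thesis by simp
qed

lemma square_less_3_if_le_pi_half:
  fixes x :: real
  assumes "0 < x" "x \<le> pi / 2"
  shows "x\<^sup>2 < 3"
proof (rule ccontr)
  assume "\<not> x\<^sup>2 < 3"
  have "x \<le> 2" using assms pi_half_less_two by linarith
  then have "x\<^sup>2 \<le> 2\<^sup>2" using assms by (intro power_mono) auto
  \<comment> \<open>With s = x^2 in [3, 4] this gives s^2 \<le> 7s - 12, so the quartic bound 1 -
    s/2 + s^2/24 is at most 1/2 - 5s/24 \<le> -1/8, whereas the cosine is nonnegative up to
    \<pi>/2.\<close>
  with \<open>\<not> x\<^sup>2 < 3\<close> have "(x\<^sup>2 - 3) * (4 - x\<^sup>2) \<ge> 0"
    by (intro mult_nonneg_nonneg) auto
  then have "1 - x\<^sup>2 / 2 + x\<^sup>2 * x\<^sup>2 / 24 \<le> 0"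
    using \<open>\<not> x\<^sup>2 < 3\<close> unfolding left_diff_distrib right_diff_distrib by linarith
  then have "1 - x\<^sup>2 / 2 + x ^ 4 / 24 \<le> 0"
    by (simp flip: power_add)
  moreover have "cos x \<ge> 0" using assms by (intro cos_ge_zero) auto
  ultimately show False using cos_less_quartic[OF assms(1)] by linarith
qed

lemma sinh_gt_self:
  fixes x :: real
  assumes "x > 0"
  shows "sinh x > x"
proof -
  have "sinh x - x > 0"
    by (rule pos_if_deriv_pos[where f = "\<lambda>y. sinh y - y"
        and f' = "\<lambda>y. cosh y - 1"])
      (auto intro!: derivative_eq_intros assms simp: cosh_real_strict_mono[of 0, simplified])
  then show ?thesis by simp
qed

lemma cosh_gt_quadratic:
  fixes x :: real
  assumes "x > 0"
  shows "cosh x > 1 + x\<^sup>2 / 2"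
proof -
  have "cosh x - (1 + x\<^sup>2 / 2) > 0"
    by (rule pos_if_deriv_pos[where f = "\<lambda>y. cosh y - (1 + y\<^sup>2 / 2)"
        and f' = "\<lambda>y. sinh y - y"])
      (auto intro!: derivative_eq_intros assms simp: sinh_gt_self)
  then show ?thesis by simp
qed

lemma sinh_gt_cubic:
  fixes x :: real
  assumes "x > 0"
  shows "sinh x > x + x ^ 3 / 6"
proof -
  have "sinh x - (x + x ^ 3 / 6) > 0"
    by (rule pos_if_deriv_pos[where f = "\<lambda>y. sinh y - (y + y ^ 3 / 6)"
        and f' = "\<lambda>y. cosh y - (1 + y\<^sup>2 / 2)"])
      (auto intro!: derivative_eq_intros assms simp: cosh_gt_quadratic)
  then show ?thesis by simp
qed

lemma sinh_squared_mult_sin_gt: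
  fixes x :: real
  assumes "0 < x" "x\<^sup>2 < 3"
  shows "(sinh x)\<^sup>2 * sin x > x ^ 3"
proof -
  define u where "u = x\<^sup>2 / 6"
  have u: "0 < u" "u < 1 / 2" using assms by (auto simp: u_def)
  \<comment> \<open>Since (1 + u)^2 (1 - u) = 1 + u - u (u + u^2), it suffices that u + u^2 < 1, and
    u < 1/2 bounds this sum by 3/4.\<close>
  have "u * (u + u\<^sup>2) < u * 1"
    using u power_strict_mono[of u "1/2" 2]
    by (intro mult_strict_left_mono) (auto simp: power2_eq_square)
  then have "(1 + u)\<^sup>2 * (1 - u) > 1"
    by (simp add: power2_eq_square algebra_simps)
  then have "x ^ 3 < x ^ 3 * ((1 + u)\<^sup>2 * (1 - u))"
    using assms by simp
  also have "\<dots> = (x + x ^ 3 / 6)\<^sup>2 * (x - x ^ 3 / 6)"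
    unfolding u_def by (simp add: power2_eq_square power3_eq_cube field_simps)
  also have "\<dots> < (sinh x)\<^sup>2 * sin x"
  proof (rule mult_strict_mono)
    show "(x + x ^ 3 / 6)\<^sup>2 < (sinh x)\<^sup>2"
      using sinh_gt_cubic[of x] assms by (intro power_strict_mono) auto
    have "x - x ^ 3 / 6 = x * (1 - u)"
      by (simp add: u_def power2_eq_square power3_eq_cube field_simps)
    then show "0 \<le> x - x ^ 3 / 6" using u assms by simp
  qed (use sin_gt_cubic[of x] assms in auto)
  finally show ?thesis .
qed

lemma sin_mult_sinh_less_square:
  fixes x :: real
  assumes "0 < x" "x \<le> pi"
  shows "sin x * sinh x < x\<^sup>2"
proof -
  \<comment> \<open>\<open>d3\<close>, \<open>d2\<close>, \<open>d1\<close> concern the third,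
    second and first derivatives of \<open>y\<^sup>2 - sin y * sinh y\<close>. All vanish at 0, so
    positivity descends from the fourth, where x \<le> \<pi> makes the sine positive.\<close>
  have d3: "2 * (sin y * cosh y - cos y * sinh y) > 0" if "0 < y" "y < x" for y
    by (rule pos_if_deriv_pos[where f = "\<lambda>y. 2 * (sin y * cosh y - cos y * sinh y)"
        and f' = "\<lambda>y. 4 * (sin y * sinh y)"])
      (use that assms in \<open>auto intro!: derivative_eq_intros simp: sin_gt_zero\<close>)
  have d2: "2 - 2 * (cos y * cosh y) > 0" if "0 < y" "y < x" for y
    by (rule pos_if_deriv_pos[where f = "\<lambda>y. 2 - 2 * (cos y * cosh y)"
        and f' = "\<lambda>y. 2 * (sin y * cosh y - cos y * sinh y)"])
      (use that d3 in \<open>auto intro!: derivative_eq_intros\<close>)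
  have d1: "2 * y - (cos y * sinh y + sin y * cosh y) > 0" if "0 < y" "y < x" for y
    by (rule pos_if_deriv_pos[where f = "\<lambda>y. 2 * y - (cos y * sinh y + sin y * cosh y)"
        and f' = "\<lambda>y. 2 - 2 * (cos y * cosh y)"])
      (use that d2 in \<open>auto intro!: derivative_eq_intros\<close>)
  have "x\<^sup>2 - sin x * sinh x > 0"
    by (rule pos_if_deriv_pos[where f = "\<lambda>y. y\<^sup>2 - sin y * sinh y"
        and f' = "\<lambda>y. 2 * y - (cos y * sinh y + sin y * cosh y)"])
      (use assms d1 in \<open>auto intro!: derivative_eq_intros\<close>)
  then show ?thesis by simp
qed

theorem theorem2:
  fixes x t :: real
  assumes "x \<in> {0<..pi / 2}" and "t > 0"
  shows "2 * (sinh x / x) powr t + (sin x / x) powr t > 3 \<and>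
         2 * (x / sin x) powr t + (x / sinh x) powr t > 3"
proof -
  have x: "0 < x" "x < pi" using assms pi_gt_zero by auto
  have sin: "sin x > 0" using x by (simp add: sin_gt_zero)
  have sinh: "sinh x > 0" using x by simp
  have "x\<^sup>2 < 3" using assms by (intro square_less_3_if_le_pi_half) auto
  then have "(sinh x)\<^sup>2 * sin x > x ^ 3" by (rule sinh_squared_mult_sin_gt[OF x(1)])
  then have "(sinh x / x)\<^sup>2 * (sin x / x) > 1"
    using x by (simp add: field_simps power2_eq_square power3_eq_cube)
  then have 1: "2 * (sinh x / x) powr t + (sin x / x) powr t > 3"
    using x sin sinh assms by (intro two_powr_add_powr_gt_3) auto
  \<comment> \<open>In the second inequality the doubled term is \<open>x / sin x\<close>, so the
    sine must enter squared: the bounds for \<open>sin x\<close> and \<open>sin x * sinh x\<close>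
    are multiplied.\<close>
  have "sin x * (sin x * sinh x) < x * x\<^sup>2"
    using x sin sinh sin_mult_sinh_less_square[of x] sin_less_self[of x]
    by (intro mult_strict_mono) auto
  then have "(x / sin x)\<^sup>2 * (x / sinh x) > 1"
    using sin sinh by (simp add: field_simps power2_eq_square)
  then have "2 * (x / sin x) powr t + (x / sinh x) powr t > 3"
    using x sin sinh assms by (intro two_powr_add_powr_gt_3) auto
  with 1 show ?thesis by simp
qed

end
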